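(* Consider a single bandit with state space $\{0,1,2,\ldots\}$ and, for each $W\in\mathbb R$, the problem of minimizing over policies $\phi$ $$\mathbb{E}(T(N^\phi,S^\phi(N^\phi)))-W\,\mathbb{E}(f(N^\phi,S^\phi(N^\phi))).$$ Assume that an optimal solution of this problem is of threshold type (for every $W$, with the same type, 0-1 or 1-0) and that the bandit is indexable. If $$\frac{\mathbb{E}(T(N^n,S^n(N^n)))-\mathbb{E}(T(N^{n-1},S^{n-1}(N^{n-1})))}{\mathbb{E}(f(N^{n},S^n(N^{n})))-\mathbb{E}(f(N^{n-1},S^{n-1}(N^{n-1})))}$$ is a monotone function of $n$, then Whittle's index $W(n)$ is given by this expression. Further, Whittle's index is non-decreasing in $n$ if 0-1 type threshold policies are optimal and non-increasing in $n$ if 1-0 type threshold policies are optimal.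
   Context: Bandit. A bandit is a controlled continuous-time Markov chain on $\{0,1,2,\ldots\}$ with two actions, $a=0$ (passive) and $a=1$ (active), transitions (at finite rates or instantaneous) depending only on the current state and action. A policy $\phi$ is a map $S^\phi$ from states to $\{0,1\}$ under which the chain is ergodic; $N^\phi$ denotes a random variable with the stationary distribution of the state under $\phi$. $\mathbb E(T(N^\phi,S^\phi(N^\phi)))\in\mathbb R$ denotes the total expected stationary cost per unit of time under $\phi$ (holding costs plus lump costs of instantaneous transitions), and $f(n,a)$ is a given real function of state and action; $\mathbb E(f(N^\phi,S^\phi(N^\phi)))\in\mathbb R$ is its stationary mean. Threshold policies. For $n\in\{-1,0,1,\ldots\}$, the 0-1 type threshold policy $n$ takes action $0$ in states $m\le n$ and action $1$ in states $m>n$; the 1-0 type threshold policy $n$ takes action $1$ in states $m\le n$ and action $0$ in states $m>n$. A superscript $n$ (as in $N^n,S^n$) refers to threshold policy $n$. "An optimal solution is of threshold type" means that for every $W$ some threshold policy (of the given type) attains the minimum over all policies. The denominators in the displayed ratio are understood to be non-zero, $n\in\{0,1,2,\ldots\}$. Indexability and Whittle's index. When threshold policies are optimal, an action is called optimal in state $m$ (for parameter $W$) if some optimal threshold policy takes that action in state $m$. Let $D(W)$ be the set of states in which passive is an optimal action. The bandit is indexable if $W'<W$ implies $D(W')\subseteq D(W)$. For an indexable bandit, Whittle's index $W(n)$ in state $n$ is the smallest value of $W$ for which an optimal policy is indifferent of the action in state $n$, i.e. for which both the passive and the active action are optimal in state $n$.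
   Formalization: The formal statement also assumes that the stationary mean of f under threshold policy n is monotone (in either direction) in n, i.e. the denominators of the ratio keep one sign; without this the claim is false, even for a strictly increasing ratio. *)

theory Defs
  imports "HOL-Probability.Probability"
begin

datatype action = Passive | Active

text \<open>
  In a given state and under a given action the process either waits and then moves to state
  \<open>m\<close> at rate \<open>q m\<close> (\<open>Timed q\<close>), or leaves at once to a state with distribution \<open>p\<close>
  (\<open>Instantaneous p\<close>). The function \<open>f\<close> that \<open>W\<close> multiplies in the objective is \<open>reward\<close>.
\<close>

datatype move = Timed "nat \<Rightarrow> real" | Instantaneous "nat pmf"

record bandit =
  move :: "nat \<Rightarrow> action \<Rightarrow> move"
  holding_cost :: "nat \<Rightarrow> action \<Rightarrow> real"
  lump_cost :: "nat \<Rightarrow> action \<Rightarrow> nat \<Rightarrow> real"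
  reward :: "nat \<Rightarrow> action \<Rightarrow> real"

definition valid_bandit :: "bandit \<Rightarrow> bool" where
  "valid_bandit B \<longleftrightarrow>
     (\<forall>n a q. move B n a = Timed q \<longrightarrow> (\<forall>m. 0 \<le> q m) \<and> q n = 0 \<and> q summable_on UNIV)"

definition instantaneous_states :: "bandit \<Rightarrow> (nat \<Rightarrow> action) \<Rightarrow> nat set" where
  "instantaneous_states B \<phi> = {n. \<exists>p. move B n (\<phi> n) = Instantaneous p}"

text \<open>
  The embedded jump chain and the mean sojourn times. An absorbing state (total rate \<open>0\<close>) is
  represented by repeated sojourns of mean \<open>1\<close> in that state; this does not change the law of
  the process.
\<close>

definition jump :: "bandit \<Rightarrow> (nat \<Rightarrow> action) \<Rightarrow> nat \<Rightarrow> nat pmf" where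
  "jump B \<phi> n = (case move B n (\<phi> n) of
       Timed q \<Rightarrow> (if infsum q UNIV = 0 then return_pmf n
                   else embed_pmf (\<lambda>m. q m / infsum q UNIV))
     | Instantaneous p \<Rightarrow> p)"

definition sojourn :: "bandit \<Rightarrow> (nat \<Rightarrow> action) \<Rightarrow> nat \<Rightarrow> real" where
  "sojourn B \<phi> n = (case move B n (\<phi> n) of
       Timed q \<Rightarrow> (if infsum q UNIV = 0 then 1 else 1 / infsum q UNIV)
     | Instantaneous p \<Rightarrow> 0)"

text \<open>
  \<open>first_passage K y k x\<close> is the probability that the discrete-time chain with kernel \<open>K\<close>,
  started in \<open>x\<close>, is in \<open>y\<close> after \<open>k + 1\<close> steps for the first time (not counting time \<open>0\<close>).
\<close>

fun first_passage :: "(nat \<Rightarrow> nat pmf) \<Rightarrow> nat \<Rightarrow> nat \<Rightarrow> nat \<Rightarrow> real" where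
  "first_passage K y 0 x = pmf (K x) y"
| "first_passage K y (Suc k) x =
     measure_pmf.expectation (K x) (\<lambda>z. if z = y then 0 else first_passage K y k z)"

text \<open>
  \<open>\<nu> n\<close> is the stationary number of visits to \<open>n\<close> per unit of time. The last conjunct says that
  the fractions of time \<open>\<nu> n * sojourn B \<phi> n\<close> add up to one. If all sojourn times are positive,
  these are the balance equations of the Markov process.
\<close>

definition stationary_visits :: "bandit \<Rightarrow> (nat \<Rightarrow> action) \<Rightarrow> (nat \<Rightarrow> real) \<Rightarrow> bool" where
  "stationary_visits B \<phi> \<nu> \<longleftrightarrow>
     (\<forall>n. 0 \<le> \<nu> n) \<and>
     (\<forall>m. ((\<lambda>n. \<nu> n * pmf (jump B \<phi> n) m) has_sum \<nu> m) UNIV) \<and>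
     ((\<lambda>n. \<nu> n * sojourn B \<phi> n) has_sum 1) UNIV"

text \<open>
  Ergodic: there is a single recurrent class, it is reached almost surely from every state, and it
  is positive recurrent. Transient states are allowed: if, say, the active action empties the
  system instantaneously, states far above a threshold are never visited.
\<close>

definition ergodic :: "bandit \<Rightarrow> (nat \<Rightarrow> action) \<Rightarrow> bool" where
  "ergodic B \<phi> \<longleftrightarrow>
     (\<exists>y. \<forall>x. (\<lambda>k. first_passage (jump B \<phi>) y k x) sums 1) \<and>
     (\<exists>\<nu>. stationary_visits B \<phi> \<nu>)"

text \<open>
  For an ergodic chain \<open>\<nu>\<close> is unique: an invariant measure of a chain that reaches \<open>y\<close> almost
  surely from everywhere is determined by its value at \<open>y\<close>, and the scale is fixed by the
  normalisation.
\<close>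

definition visit_rate :: "bandit \<Rightarrow> (nat \<Rightarrow> action) \<Rightarrow> nat \<Rightarrow> real" where
  "visit_rate B \<phi> = (THE \<nu>. stationary_visits B \<phi> \<nu>)"

definition stationary :: "bandit \<Rightarrow> (nat \<Rightarrow> action) \<Rightarrow> nat pmf" where
  "stationary B \<phi> = embed_pmf (\<lambda>n. visit_rate B \<phi> n * sojourn B \<phi> n)"

definition lump_flow :: "bandit \<Rightarrow> (nat \<Rightarrow> action) \<Rightarrow> nat \<times> nat \<Rightarrow> real" where
  "lump_flow B \<phi> = (\<lambda>(n, m). visit_rate B \<phi> n * pmf (jump B \<phi> n) m * lump_cost B n (\<phi> n) m)"

definition mean_cost :: "bandit \<Rightarrow> (nat \<Rightarrow> action) \<Rightarrow> real" where
  "mean_cost B \<phi> =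
     measure_pmf.expectation (stationary B \<phi>) (\<lambda>n. holding_cost B n (\<phi> n)) +
     infsum (lump_flow B \<phi>) (instantaneous_states B \<phi> \<times> UNIV)"

definition mean_reward :: "bandit \<Rightarrow> (nat \<Rightarrow> action) \<Rightarrow> real" where
  "mean_reward B \<phi> = measure_pmf.expectation (stationary B \<phi>) (\<lambda>n. reward B n (\<phi> n))"

text \<open>The last three conjuncts say that the stationary means exist as real numbers.\<close>

definition is_policy :: "bandit \<Rightarrow> (nat \<Rightarrow> action) \<Rightarrow> bool" where
  "is_policy B \<phi> \<longleftrightarrow>
     ergodic B \<phi> \<and>
     integrable (measure_pmf (stationary B \<phi>)) (\<lambda>n. holding_cost B n (\<phi> n)) \<and>
     lump_flow B \<phi> summable_on (instantaneous_states B \<phi> \<times> UNIV) \<and>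
     integrable (measure_pmf (stationary B \<phi>)) (\<lambda>n. reward B n (\<phi> n))"

definition objective :: "bandit \<Rightarrow> real \<Rightarrow> (nat \<Rightarrow> action) \<Rightarrow> real" where
  "objective B W \<phi> = mean_cost B \<phi> - W * mean_reward B \<phi>"

definition optimal :: "bandit \<Rightarrow> real \<Rightarrow> (nat \<Rightarrow> action) \<Rightarrow> bool" where
  "optimal B W \<phi> \<longleftrightarrow>
     is_policy B \<phi> \<and> (\<forall>\<psi>. is_policy B \<psi> \<longrightarrow> objective B W \<phi> \<le> objective B W \<psi>)"

datatype threshold_type = Zero_One | One_Zero

text \<open>Thresholds range over the integers \<open>n \<ge> -1\<close>.\<close>

fun threshold :: "threshold_type \<Rightarrow> int \<Rightarrow> nat \<Rightarrow> action" where
  "threshold Zero_One n m = (if int m \<le> n then Passive else Active)"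
| "threshold One_Zero n m = (if int m \<le> n then Active else Passive)"

definition threshold_optimal :: "threshold_type \<Rightarrow> bandit \<Rightarrow> bool" where
  "threshold_optimal ty B \<longleftrightarrow> (\<forall>W. \<exists>n\<ge>-1. optimal B W (threshold ty n))"

definition optimal_action :: "threshold_type \<Rightarrow> bandit \<Rightarrow> real \<Rightarrow> nat \<Rightarrow> action \<Rightarrow> bool" where
  "optimal_action ty B W m a \<longleftrightarrow>
     (\<exists>n\<ge>-1. optimal B W (threshold ty n) \<and> threshold ty n m = a)"

definition passive_set :: "threshold_type \<Rightarrow> bandit \<Rightarrow> real \<Rightarrow> nat set" where
  "passive_set ty B W = {m. optimal_action ty B W m Passive}"

definition indexable :: "threshold_type \<Rightarrow> bandit \<Rightarrow> bool" where
  "indexable ty B \<longleftrightarrow> (\<forall>W' W. W' < W \<longrightarrow> passive_set ty B W' \<subseteq> passive_set ty B W)"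

definition indifferent :: "threshold_type \<Rightarrow> bandit \<Rightarrow> nat \<Rightarrow> real \<Rightarrow> bool" where
  "indifferent ty B n W \<longleftrightarrow> optimal_action ty B W n Passive \<and> optimal_action ty B W n Active"

definition is_whittle_index :: "threshold_type \<Rightarrow> bandit \<Rightarrow> nat \<Rightarrow> real \<Rightarrow> bool" where
  "is_whittle_index ty B n w \<longleftrightarrow>
     indifferent ty B n w \<and> (\<forall>W. indifferent ty B n W \<longrightarrow> w \<le> W)"

definition whittle_index :: "threshold_type \<Rightarrow> bandit \<Rightarrow> nat \<Rightarrow> real" where
  "whittle_index ty B n = (THE w. is_whittle_index ty B n w)"

definition threshold_cost :: "threshold_type \<Rightarrow> bandit \<Rightarrow> int \<Rightarrow> real" where
  "threshold_cost ty B n = mean_cost B (threshold ty n)"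

definition threshold_reward :: "threshold_type \<Rightarrow> bandit \<Rightarrow> int \<Rightarrow> real" where
  "threshold_reward ty B n = mean_reward B (threshold ty n)"

definition threshold_ratio :: "threshold_type \<Rightarrow> bandit \<Rightarrow> nat \<Rightarrow> real" where
  "threshold_ratio ty B n =
     (threshold_cost ty B (int n) - threshold_cost ty B (int n - 1)) /
     (threshold_reward ty B (int n) - threshold_reward ty B (int n - 1))"

end

theory Submission
  imports Defs
begin

text \<open>
  With \<open>t\<close> and \<open>r\<close> the mean cost and reward of the threshold policies, the problem for \<open>W\<close> is to
  minimise the affine functions \<open>t k - W * r k\<close> of \<open>W\<close> over \<open>k\<close>, and an exchange argument shows
  that minimisers move in the direction in which \<open>r\<close> grows as \<open>W\<close> increases. Indexability therefore
  forces \<open>r\<close> to increase in the threshold for 0-1 type policies and to decrease for 1-0 type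
  policies. The increment of \<open>t k - W * r k\<close> is \<open>(r (Suc k) - r k) * (ratio k - W)\<close>. If the ratio
  were monotone in the wrong direction, then for suitable \<open>W\<close> all increments would be negative, and
  no minimum would exist. If it is monotone in the right direction, the functions are unimodal
  in \<open>k\<close>, and the minimiser passes from \<open>n\<close> to \<open>Suc n\<close> exactly at \<open>W = ratio n\<close>.
  Replacing \<open>r\<close> and \<open>W\<close> by their negatives reduces type 1-0 to increasing \<open>r\<close>.
\<close>

section \<open>Minimisers of the affine functions \<open>t k - W * r k\<close>\<close>

definition minimizer :: "(nat \<Rightarrow> real) \<Rightarrow> (nat \<Rightarrow> real) \<Rightarrow> real \<Rightarrow> nat \<Rightarrow> bool" where
  "minimizer t r W k \<longleftrightarrow> (\<forall>j. t k - W * r k \<le> t j - W * r j)"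

definition slope :: "(nat \<Rightarrow> real) \<Rightarrow> (nat \<Rightarrow> real) \<Rightarrow> nat \<Rightarrow> real" where
  "slope t r n = (t (Suc n) - t n) / (r (Suc n) - r n)"

lemma minimizer_uminus: "minimizer t (\<lambda>k. - r k) W k \<longleftrightarrow> minimizer t r (- W) k"
  by (simp add: minimizer_def)

lemma slope_uminus: "slope t (\<lambda>k. - r k) n = - slope t r n"
proof -
  have "- r (Suc n) - - r n = - (r (Suc n) - r n)" by simp
  then show ?thesis
    unfolding slope_def by (simp only: minus_divide_right)
qed

text \<open>Adding the two minimality inequalities cancels \<open>t\<close> and leaves a product
  with the positive factor \<open>W - W'\<close>.\<close>

lemma minimizer_exchange:
  assumes "minimizer t r W k" and "minimizer t r W' k'" and "W' < W"
  shows "r k' \<le> r k"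
proof -
  have "t k - W * r k \<le> t k' - W * r k'" "t k' - W' * r k' \<le> t k - W' * r k"
    using assms by (auto simp: minimizer_def)
  then have "0 \<le> (W - W') * (r k - r k')"
    by (simp add: algebra_simps)
  with \<open>W' < W\<close> show ?thesis
    by (simp add: zero_le_mult_iff)
qed

lemma increment_eq:
  assumes "r (Suc n) \<noteq> r n"
  shows "t (Suc n) - W * r (Suc n) - (t n - W * r n) = (r (Suc n) - r n) * (slope t r n - W)"
proof -
  have "(r (Suc n) - r n) * slope t r n = t (Suc n) - t n"
    using assms by (simp add: slope_def)
  then show ?thesis
    by (simp add: algebra_simps)
qed

lemma
  assumes "strict_mono r"
  shows minimizer_Suc_ge_slope: "minimizer t r W (Suc k) \<Longrightarrow> slope t r k \<le> W"
    and minimizer_le_slope: "minimizer t r W k \<Longrightarrow> W \<le> slope t r k"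
proof -
  have pos: "r (Suc k) - r k > 0"
    using assms by (simp add: strict_mono_Suc_iff)
  then have eq: "t (Suc k) - W * r (Suc k) - (t k - W * r k) = (r (Suc k) - r k) * (slope t r k - W)"
    by (intro increment_eq) simp
  show "slope t r k \<le> W" if "minimizer t r W (Suc k)"
  proof -
    have "t (Suc k) - W * r (Suc k) - (t k - W * r k) \<le> 0"
      using that by (auto simp: minimizer_def)
    with eq pos show ?thesis
      by (simp add: mult_le_0_iff)
  qed
  show "W \<le> slope t r k" if "minimizer t r W k"
  proof -
    have "t (Suc k) - W * r (Suc k) - (t k - W * r k) \<ge> 0"
      using that by (auto simp: minimizer_def)
    with eq pos show ?thesis
      by (simp add: zero_le_mult_iff)
  qed
qed

lemma unimodal_min:
  fixes g :: "nat \<Rightarrow> real"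
  assumes up: "\<And>j. n \<le> j \<Longrightarrow> g j \<le> g (Suc j)" and down: "\<And>j. j < n \<Longrightarrow> g (Suc j) \<le> g j"
  shows "g n \<le> g j"
proof (cases "n \<le> j")
  case True
  then show ?thesis
    by (induction j rule: dec_induct) (use up in force)+
next
  case False
  then have "j \<le> n" by simp
  then show ?thesis
    by (induction j rule: inc_induct) (use down in force)+
qed

text \<open>For \<open>W = slope t r n\<close> the increments are nonpositive before
  \<open>n\<close>, zero at \<open>n\<close> and nonnegative after it, so \<open>n\<close> and
  \<open>Suc n\<close> tie for the minimum.\<close>

lemma minimizer_at_slope:
  assumes r: "strict_mono r" and s: "mono (slope t r)"
  shows "minimizer t r (slope t r n) n" and "minimizer t r (slope t r n) (Suc n)"
proof -
  define g where "g j = t j - slope t r n * r j" for j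
  have pos: "r (Suc j) - r j > 0" for j
    using r by (simp add: strict_mono_Suc_iff)
  have eq: "g (Suc j) - g j = (r (Suc j) - r j) * (slope t r j - slope t r n)" for j
    unfolding g_def using pos[of j] by (intro increment_eq) simp
  have min: "g n \<le> g j" for j
  proof (rule unimodal_min)
    fix j assume "n \<le> j"
    then have "g (Suc j) - g j \<ge> 0"
      unfolding eq using pos[of j] monoD[OF s] by (intro mult_nonneg_nonneg) auto
    then show "g j \<le> g (Suc j)" by simp
  next
    fix j assume "j < n"
    then have "g (Suc j) - g j \<le> 0"
      unfolding eq using pos[of j] monoD[OF s] by (intro mult_nonneg_nonpos) auto
    then show "g (Suc j) \<le> g j" by simp
  qed
  moreover have "g (Suc n) = g n"
    using eq[of n] by simp
  ultimately show "minimizer t r (slope t r n) n" "minimizer t r (slope t r n) (Suc n)"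
    by (auto simp: minimizer_def g_def)
qed

text \<open>A minimiser for \<open>W\<close> has slope at least \<open>W\<close>, but an antitone
  slope never exceeds \<open>slope t r 0\<close>.\<close>

lemma slope_mono:
  assumes r: "strict_mono r" and ex: "\<And>W. \<exists>k. minimizer t r W k"
    and s: "mono (slope t r) \<or> antimono (slope t r)"
  shows "mono (slope t r)"
proof (rule ccontr)
  assume "\<not> mono (slope t r)"
  with s have "antimono (slope t r)" by simp
  obtain k where "minimizer t r (slope t r 0 + 1) k"
    using ex by blast
  then have "slope t r 0 + 1 \<le> slope t r k"
    using minimizer_le_slope[OF r] by blast
  also have "\<dots> \<le> slope t r 0"
    using \<open>antimono (slope t r)\<close> by (simp add: antimonoD)
  finally show False by simp
qed

section \<open>Excluding decreasing \<open>r\<close>\<close>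

lemma not_eventually_minimizer:
  assumes "r k < r j"
  shows "\<exists>W>W0. \<not> minimizer t r W k"
proof -
  \<comment> \<open>The value of \<open>W\<close> at which the affine functions of \<open>j\<close>
    and \<open>k\<close> cross; beyond it the one with larger \<open>r\<close> is lower.\<close>
  define c where "c = (t j - t k) / (r j - r k)"
  have "\<not> minimizer t r W k" if "c < W" for W
  proof -
    have "t j - t k < W * (r j - r k)"
      using that assms by (simp add: c_def divide_less_eq)
    then have "t j - W * r j < t k - W * r k"
      by (simp add: algebra_simps)
    then show ?thesis
      by (meson minimizer_def not_less)
  qed
  then show ?thesis
    by (intro exI[of _ "max c W0 + 1"]) auto
qed

lemma not_frequently_minimizer:
  assumes "r j < r k"
  shows "\<exists>W<W0. \<not> minimizer t r W k"
  using not_eventually_minimizer[of "\<lambda>k. - r k" k j "- W0" t] assms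
  unfolding minimizer_uminus by (metis minus_less_iff neg_less_iff_less)

text \<open>The exchange inequality pushes minimisers down as \<open>W\<close> grows and
  \<open>asc\<close> pushes them up, so a minimiser persists for all larger \<open>W\<close>. A
  persisting \<open>k' > 0\<close> is eventually beaten by \<open>0\<close>, where \<open>r\<close>
  is larger.\<close>

lemma not_antitone_if_minimizers_ascend:
  assumes r: "strict_mono (\<lambda>k. - r k)" and ex: "\<And>W. \<exists>k. minimizer t r W k"
    and asc: "\<And>W W' k'. W' < W \<Longrightarrow> minimizer t r W' k' \<Longrightarrow> \<exists>k\<ge>k'. minimizer t r W k"
  shows False
proof -
  have less_iff: "r i < r j \<longleftrightarrow> j < i" for i j
    using strict_mono_less[OF r, of j i] by simp
  have persist: "minimizer t r W k'" if *: "W' < W" "minimizer t r W' k'" for W W' k'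
  proof -
    obtain k where k: "k \<ge> k'" "minimizer t r W k"
      using asc[OF *] by blast
    have "r k' \<le> r k"
      using minimizer_exchange[OF k(2) *(2,1)] .
    then have "k = k'"
      using k(1) less_iff[of k k'] by linarith
    with k show ?thesis by simp
  qed
  \<comment> \<open>\<open>0\<close> has the largest \<open>r\<close> and cannot be beaten for large
    \<open>W\<close>, so the start is a \<open>W'\<close> small enough that \<open>1\<close> beats
    \<open>0\<close>.\<close>
  obtain W' where W': "\<not> minimizer t r W' 0"
    using not_frequently_minimizer[of r 1 0] less_iff[of 1 0] by auto
  obtain k' where k': "minimizer t r W' k'"
    using ex by blast
  with W' have "r k' < r 0"
    using less_iff by (cases k') auto
  then show False
    using not_eventually_minimizer persist[OF _ k'] by blast
qed

text \<open>The same conflict read towards smaller \<open>W\<close>: a minimiser \<open>k\<close>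
  persists, yet \<open>Suc k\<close> has smaller \<open>r\<close> and beats it for some smaller
  \<open>W\<close>.\<close>

lemma not_antitone_if_minimizers_descend:
  assumes r: "strict_mono (\<lambda>k. - r k)" and ex: "\<And>W. \<exists>k. minimizer t r W k"
    and desc: "\<And>W W' k. W' < W \<Longrightarrow> minimizer t r W k \<Longrightarrow> \<exists>k'\<le>k. minimizer t r W' k'"
  shows False
proof -
  have less_iff: "r i < r j \<longleftrightarrow> j < i" for i j
    using strict_mono_less[OF r, of j i] by simp
  obtain k where k: "minimizer t r 0 k"
    using ex by blast
  have "minimizer t r W' k" if *: "W' < 0" for W'
  proof -
    obtain k' where k': "k' \<le> k" "minimizer t r W' k'"
      using desc[OF * k] by blast
    have "r k' \<le> r k"
      using minimizer_exchange[OF k k'(2) *] .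
    then have "k' = k"
      using k'(1) less_iff[of k k'] by linarith
    with k' show ?thesis by simp
  qed
  moreover have "r (Suc k) < r k"
    by (simp add: less_iff)
  ultimately show False
    using not_frequently_minimizer by blast
qed

section \<open>Threshold policies as a sequence\<close>

lemma threshold_eq_iff:
  "threshold Zero_One (int k - 1) m = Passive \<longleftrightarrow> m < k"
  "threshold Zero_One (int k - 1) m = Active \<longleftrightarrow> k \<le> m"
  "threshold One_Zero (int k - 1) m = Passive \<longleftrightarrow> k \<le> m"
  "threshold One_Zero (int k - 1) m = Active \<longleftrightarrow> m < k"
  by auto

lemma bex_threshold_iff: "(\<exists>n\<ge>-1. P n) \<longleftrightarrow> (\<exists>k. P (int k - 1))"
proof
  assume "\<exists>n\<ge>-1. P n"
  then obtain n where "n \<ge> -1" "P n" by blast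
  then show "\<exists>k. P (int k - 1)"
    by (intro exI[of _ "nat (n + 1)"]) simp
next
  assume "\<exists>k. P (int k - 1)"
  then obtain k where "P (int k - 1)" by blast
  then show "\<exists>n\<ge>-1. P n"
    by (intro exI[of _ "int k - 1"]) simp
qed

lemma is_whittle_index_imp_eq:
  assumes "is_whittle_index ty B n w"
  shows "whittle_index ty B n = w"
  unfolding whittle_index_def
proof (rule the_equality)
  show "is_whittle_index ty B n w" by fact
  show "w' = w" if "is_whittle_index ty B n w'" for w'
    using that assms by (meson is_whittle_index_def order_antisym)
qed

text \<open>
  Index \<open>k\<close> of the sequences stands for threshold \<open>k - 1\<close>, so that thresholds start at \<open>-1\<close>.
\<close>

locale threshold_bandit =
  fixes B :: bandit and ty :: threshold_type and t r :: "nat \<Rightarrow> real"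
  assumes policies: "\<And>n. n \<ge> -1 \<Longrightarrow> is_policy B (threshold ty n)"
    and thr_opt: "threshold_optimal ty B"
    and idx: "indexable ty B"
    and reward_neq: "\<And>n. threshold_reward ty B (int n) - threshold_reward ty B (int n - 1) \<noteq> 0"
    and reward_mono: "mono_on {-1..} (threshold_reward ty B) \<or>
      antimono_on {-1..} (threshold_reward ty B)"
    and ratio_mono: "mono (threshold_ratio ty B) \<or> antimono (threshold_ratio ty B)"
  defines "t \<equiv> \<lambda>k. threshold_cost ty B (int k - 1)"
    and "r \<equiv> \<lambda>k. threshold_reward ty B (int k - 1)"
begin

lemma objective_threshold: "objective B W (threshold ty (int k - 1)) = t k - W * r k"
  by (simp add: objective_def t_def r_def threshold_cost_def threshold_reward_def)

text \<open>Optimality compares with all policies, but some threshold policy attains the overall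
  minimum, so being best among thresholds suffices.\<close>

lemma optimal_iff_minimizer: "optimal B W (threshold ty (int k - 1)) \<longleftrightarrow> minimizer t r W k"
proof
  assume "optimal B W (threshold ty (int k - 1))"
  then show "minimizer t r W k"
    unfolding minimizer_def optimal_def objective_threshold[symmetric] by (simp add: policies)
next
  assume min: "minimizer t r W k"
  obtain j where j: "optimal B W (threshold ty (int j - 1))"
    using thr_opt unfolding threshold_optimal_def bex_threshold_iff by blast
  have "objective B W (threshold ty (int k - 1)) \<le> objective B W (threshold ty (int j - 1))"
    using min unfolding minimizer_def objective_threshold by blast
  with j show "optimal B W (threshold ty (int k - 1))"
    unfolding optimal_def using policies[of "int k - 1"] by force
qed

lemma ex_minimizer: "\<exists>k. minimizer t r W k"
  using thr_opt unfolding threshold_optimal_def bex_threshold_iff optimal_iff_minimizer by blast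

lemma optimal_action_iff:
  "optimal_action ty B W m a \<longleftrightarrow> (\<exists>k. minimizer t r W k \<and> threshold ty (int k - 1) m = a)"
  unfolding optimal_action_def bex_threshold_iff optimal_iff_minimizer ..

lemma threshold_ratio_eq_slope: "threshold_ratio ty B = slope t r"
  by (rule ext) (simp add: threshold_ratio_def slope_def t_def r_def)

text \<open>Non-zero denominators turn weak monotonicity into strict.\<close>

lemma reward_strict: "strict_mono r \<or> strict_mono (\<lambda>k. - r k)"
proof -
  have neq: "r (Suc k) \<noteq> r k" for k
    using reward_neq[of k] by (simp add: r_def)
  from reward_mono show ?thesis
  proof
    assume "mono_on {-1..} (threshold_reward ty B)"
    then have "r k \<le> r (Suc k)" for k
      unfolding r_def by (rule mono_onD) auto
    with neq show ?thesis
      by (metis order_le_less strict_mono_Suc_iff)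
  next
    assume "antimono_on {-1..} (threshold_reward ty B)"
    then have "r (Suc k) \<le> r k" for k
      unfolding r_def by (rule monotone_onD) auto
    with neq have "strict_mono (\<lambda>k. - r k)"
      by (simp add: strict_mono_Suc_iff order.strict_iff_order neq[symmetric])
    then show ?thesis ..
  qed
qed

lemma passive_set_mono:
  "W' < W \<Longrightarrow> optimal_action ty B W' m Passive \<Longrightarrow> optimal_action ty B W m Passive"
  using idx unfolding indexable_def passive_set_def by blast

section \<open>Whittle's index for each threshold type\<close>

lemma whittle_Zero_One:
  assumes ty: "ty = Zero_One"
  shows "is_whittle_index ty B n (slope t r n)" and "mono (slope t r)"
proof -
  have passive_iff: "optimal_action ty B W m Passive \<longleftrightarrow> (\<exists>k>m. minimizer t r W k)" for W m
    unfolding optimal_action_iff unfolding ty threshold_eq_iff by blast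
  have active_iff: "optimal_action ty B W m Active \<longleftrightarrow> (\<exists>k\<le>m. minimizer t r W k)" for W m
    unfolding optimal_action_iff unfolding ty threshold_eq_iff by blast
  have r: "strict_mono r"
  proof (rule ccontr)
    assume "\<not> strict_mono r"
    then have "strict_mono (\<lambda>k. - r k)"
      using reward_strict by blast
    then show False
    proof (rule not_antitone_if_minimizers_ascend[OF _ ex_minimizer])
      fix W W' k' assume *: "W' < W" "minimizer t r W' k'"
      show "\<exists>k\<ge>k'. minimizer t r W k"
      \<comment> \<open>A minimiser \<open>Suc m\<close> makes passive optimal in \<open>m\<close>;
        indexability keeps it so for \<open>W\<close>, which yields a minimiser above
        \<open>m\<close>. For \<open>0\<close> any minimiser will do.\<close>
      proof (cases k')
        case 0
        then show ?thesis using ex_minimizer by auto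
      next
        case (Suc m)
        with * have "optimal_action ty B W m Passive"
          by (intro passive_set_mono[of W' W m]) (auto simp: passive_iff)
        with Suc show ?thesis
          by (auto simp: passive_iff Suc_le_eq)
      qed
    qed
  qed
  show s: "mono (slope t r)"
    using slope_mono[OF r ex_minimizer] ratio_mono unfolding threshold_ratio_eq_slope by blast
  have "indifferent ty B n (slope t r n)"
    unfolding indifferent_def passive_iff active_iff using minimizer_at_slope[OF r s, of n] by blast
  moreover have "slope t r n \<le> W" if W: "indifferent ty B n W" for W
  proof -
    \<comment> \<open>Passive optimal in \<open>n\<close> means a minimiser beyond \<open>n\<close>;
      then \<open>slope t r n \<le> slope t r k \<le> W\<close>.\<close>
    obtain k where "n \<le> k" "minimizer t r W (Suc k)"
      using W unfolding indifferent_def passive_iff by (metis Suc_le_D Suc_le_eq Suc_le_mono)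
    then show ?thesis
      using minimizer_Suc_ge_slope[OF r] monoD[OF s] order_trans by blast
  qed
  ultimately show "is_whittle_index ty B n (slope t r n)"
    by (simp add: is_whittle_index_def)
qed

lemma whittle_One_Zero:
  assumes ty: "ty = One_Zero"
  shows "is_whittle_index ty B n (slope t r n)" and "antimono (slope t r)"
proof -
  define r' where "r' = (\<lambda>k. - r k)"
  have min': "minimizer t r' W k \<longleftrightarrow> minimizer t r (- W) k" for W k
    unfolding r'_def by (rule minimizer_uminus)
  have slope': "slope t r' = (\<lambda>k. - slope t r k)"
    unfolding r'_def by (rule ext) (rule slope_uminus)
  have ex': "\<exists>k. minimizer t r' W k" for W
    unfolding min' by (rule ex_minimizer)
  have passive_iff: "optimal_action ty B W m Passive \<longleftrightarrow> (\<exists>k\<le>m. minimizer t r' (- W) k)" for W m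
    unfolding optimal_action_iff unfolding ty threshold_eq_iff min' minus_minus by blast
  have active_iff: "optimal_action ty B W m Active \<longleftrightarrow> (\<exists>k>m. minimizer t r' (- W) k)" for W m
    unfolding optimal_action_iff unfolding ty threshold_eq_iff min' minus_minus by blast
  \<comment> \<open>Passive sets that grow with \<open>W\<close> make the minimisers for
    \<open>r'\<close> descend as the parameter \<open>- W\<close> falls.\<close>
  have r': "strict_mono r'"
  proof (rule ccontr)
    assume "\<not> strict_mono r'"
    then have "strict_mono (\<lambda>k. - r' k)"
      using reward_strict by (auto simp: r'_def)
    then show False
    proof (rule not_antitone_if_minimizers_descend[OF _ ex'])
      fix W W' k assume "W' < W" "minimizer t r' W k"
      then have "optimal_action ty B (- W') k Passive"
        by (intro passive_set_mono[of "- W" "- W'" k]) (auto simp: passive_iff)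
      then show "\<exists>k'\<le>k. minimizer t r' W' k'"
        by (simp add: passive_iff)
    qed
  qed
  have "mono (slope t r') \<or> antimono (slope t r')"
    using ratio_mono unfolding threshold_ratio_eq_slope slope' by (auto simp: monotone_def)
  then have s': "mono (slope t r')"
    by (rule slope_mono[OF r' ex'])
  then show "antimono (slope t r)"
    unfolding slope' by (simp add: monotone_def)
  have "indifferent ty B n (slope t r n)"
    unfolding indifferent_def passive_iff active_iff
    using minimizer_at_slope[OF r' s', of n] by (auto simp: slope')
  moreover have "slope t r n \<le> W" if W: "indifferent ty B n W" for W
  proof -
    \<comment> \<open>The sign change turns the lower bound on \<open>W\<close> into an upper bound
      on \<open>- W\<close>, which a minimiser at or below \<open>n\<close> supplies.\<close>
    obtain k where "k \<le> n" "minimizer t r' (- W) k"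
      using W unfolding indifferent_def passive_iff by blast
    then have "- W \<le> slope t r' n"
      using minimizer_le_slope[OF r'] monoD[OF s'] order_trans by blast
    then show ?thesis
      by (simp add: slope')
  qed
  ultimately show "is_whittle_index ty B n (slope t r n)"
    by (simp add: is_whittle_index_def)
qed

lemma is_whittle_index_ratio: "is_whittle_index ty B n (threshold_ratio ty B n)"
  unfolding threshold_ratio_eq_slope
  by (cases ty) (erule whittle_Zero_One(1), erule whittle_One_Zero(1))

lemma whittle_index_eq_ratio: "whittle_index ty B = threshold_ratio ty B"
  by (rule ext) (rule is_whittle_index_imp_eq[OF is_whittle_index_ratio])

end

theorem proposition3:
  fixes B :: bandit and ty :: threshold_type
  assumes "valid_bandit B"
    and "\<And>n. n \<ge> -1 \<Longrightarrow> is_policy B (threshold ty n)"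
    and "threshold_optimal ty B"
    and "indexable ty B"
    and "\<And>n. threshold_reward ty B (int n) - threshold_reward ty B (int n - 1) \<noteq> 0"
    and "mono_on {-1..} (threshold_reward ty B) \<or> antimono_on {-1..} (threshold_reward ty B)"
    and "mono (threshold_ratio ty B) \<or> antimono (threshold_ratio ty B)"
  shows "(\<forall>n. is_whittle_index ty B n (threshold_ratio ty B n) \<and>
              whittle_index ty B n = threshold_ratio ty B n) \<and>
         (ty = Zero_One \<longrightarrow> mono (whittle_index ty B)) \<and>
         (ty = One_Zero \<longrightarrow> antimono (whittle_index ty B))"
proof -
  interpret threshold_bandit B ty "\<lambda>k. threshold_cost ty B (int k - 1)"
    "\<lambda>k. threshold_reward ty B (int k - 1)"
    by unfold_locales (use assms in auto)
  show ?thesis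
    using is_whittle_index_ratio whittle_Zero_One(2) whittle_One_Zero(2)
    unfolding whittle_index_eq_ratio threshold_ratio_eq_slope by blast
qed

end
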